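(* Let $n\in\mathbb{N}$ and let $A=\sum_{i=1}^{m}x_iP_i\in\mathcal{B}_n$, where $P_1,\ldots,P_m$ are $n\times n$ permutation matrices and $x_i>0$ for all $i\in\{1,\ldots,m\}$ with $\sum_{i=1}^{m}x_i=1$. If $A$ is an Erdős matrix, then $\mathbf{x}=(x_1,\ldots,x_m)^{T}\in\mathbb{R}^m$ solves the system of equations $$M\mathbf{x}=\langle M\mathbf{x},\mathbf{x}\rangle\,\mathbf{1}_m,$$ where $M\in\mathbb{R}^{m\times m}$ is the matrix with $M_{i,j}=\langle P_i,P_j\rangle_{\mathrm{F}}$ and $\mathbf{1}_m\in\mathbb{R}^m$ is the vector all of whose coordinates are $1$.
   Context: $\mathcal{B}_n$ denotes the set of $n\times n$ bistochastic matrices: real matrices with non-negative entries whose rows and columns each sum to $1$. The Frobenius inner product of real $n\times n$ matrices is $\langle A,B\rangle_{\mathrm{F}}=\mathrm{Tr}(AB^{T})$, and $\|A\|_{\mathrm{F}}^2=\langle A,A\rangle_{\mathrm{F}}=\sum_{i,j}A_{i,j}^2$. The maximal trace of $A$ is $\mathrm{maxTrace}(A)=\max_{\sigma\in S_n}\sum_{i=1}^{n}A_{i,\sigma(i)}$, where $S_n$ is the set of permutations of $\{1,\ldots,n\}$. A matrix $A\in\mathcal{B}_n$ is an Erdős matrix if $\|A\|_{\mathrm{F}}^2=\mathrm{maxTrace}(A)$. $\langle\cdot,\cdot\rangle$ (without subscript) is the usual inner product on $\mathbb{R}^m$. *)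

theory Defs
  imports "HOL-Analysis.Analysis"
begin

definition bistochastic :: "(real ^ 'n ^ 'n) set" where
  "bistochastic = {A. (\<forall>i j. 0 \<le> A $ i $ j)
                    \<and> (\<forall>i. (\<Sum>j\<in>UNIV. A $ i $ j) = 1)
                    \<and> (\<forall>j. (\<Sum>i\<in>UNIV. A $ i $ j) = 1)}"

definition permutation_matrix :: "real ^ 'n ^ 'n \<Rightarrow> bool" where
  "permutation_matrix P \<longleftrightarrow>
     (\<exists>\<sigma>. \<sigma> permutes (UNIV :: 'n set) \<and> P = (\<chi> i j. if j = \<sigma> i then 1 else 0))"

definition frobenius_inner :: "real ^ 'n ^ 'n \<Rightarrow> real ^ 'n ^ 'n \<Rightarrow> real" where
  "frobenius_inner A B = trace (A ** transpose B)"

definition frobenius_norm :: "real ^ 'n ^ 'n \<Rightarrow> real" where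
  "frobenius_norm A = sqrt (frobenius_inner A A)"

definition maxTrace :: "real ^ 'n ^ 'n \<Rightarrow> real" where
  "maxTrace A = Max ((\<lambda>\<sigma>. \<Sum>i\<in>UNIV. A $ i $ \<sigma> i) ` {\<sigma>. \<sigma> permutes (UNIV :: 'n set)})"

definition erdos_matrix :: "real ^ 'n ^ 'n \<Rightarrow> bool" where
  "erdos_matrix A \<longleftrightarrow> A \<in> bistochastic \<and> (frobenius_norm A)\<^sup>2 = maxTrace A"

lemma frobenius_norm_power2:
  fixes A :: "real ^ 'n ^ 'n"
  shows "(frobenius_norm A)\<^sup>2 = (\<Sum>i\<in>UNIV. \<Sum>j\<in>UNIV. (A $ i $ j)\<^sup>2)"
proof -
  have "frobenius_inner A A = (\<Sum>i\<in>UNIV. \<Sum>j\<in>UNIV. (A $ i $ j)\<^sup>2)"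
    by (simp add: frobenius_inner_def trace_def matrix_matrix_mult_def transpose_def power2_eq_square)
  moreover have "\<dots> \<ge> 0" by (intro sum_nonneg) simp
  ultimately show ?thesis by (simp add: frobenius_norm_def)
qed

end

theory Submission
  imports Defs
begin

text \<open>
  Testing \<open>A\<close> against one of the matrices \<open>P i\<close> adds up the entries of \<open>A\<close> along a permutation, so
  \<open>P i \<bullet> A \<le> maxTrace A\<close>. For an Erdos matrix this bound equals
  \<open>A \<bullet> A = (\<Sum>i\<in>UNIV. x $ i * (P i \<bullet> A))\<close>, which is a weighted mean of the very numbers being
  bounded. A mean with positive weights reaches an upper bound of its terms only if every
  term does (\<open>weighted_mean_attains_bound\<close>), so all \<open>P i \<bullet> A\<close> coincide with \<open>A \<bullet> A\<close>.
  These numbers are the coordinates of \<open>M *v x\<close>, and \<open>A \<bullet> A = (M *v x) \<bullet> x\<close>, which is the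
  claimed system. The inner product \<open>\<bullet>\<close> on matrices, viewed as vectors of rows, is the
  Frobenius one (\<open>frobenius_inner_eq_inner\<close>), so its bilinearity is available throughout.
\<close>

lemma frobenius_inner_eq_inner: "frobenius_inner A B = A \<bullet> B"
  by (simp add: frobenius_inner_def trace_def matrix_matrix_mult_def transpose_def inner_vec_def)

lemma permutation_matrix_inner_le_maxTrace:
  fixes A :: "real ^ 'n ^ 'n"
  assumes "permutation_matrix P"
  shows "P \<bullet> A \<le> maxTrace A"
proof -
  obtain \<sigma> where \<sigma>: "\<sigma> permutes (UNIV :: 'n set)"
    and P: "P = (\<chi> i j. if j = \<sigma> i then 1 else 0)"
    using assms unfolding permutation_matrix_def by blast
  have "P \<bullet> A = (\<Sum>i\<in>UNIV. \<Sum>j\<in>UNIV. if j = \<sigma> i then A $ i $ j else 0)"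
    unfolding P inner_vec_def by (intro sum.cong refl) simp
  also have "\<dots> = (\<Sum>i\<in>UNIV. A $ i $ \<sigma> i)"
    by simp
  also have "\<dots> \<le> maxTrace A"
    unfolding maxTrace_def using \<sigma> by (intro Max_ge) (auto simp: finite_permutations)
  finally show ?thesis .
qed

text \<open>
  The deficits \<open>c - f i\<close> are nonnegative and have weighted sum \<open>0\<close>, so each of them vanishes.
\<close>
lemma weighted_mean_attains_bound:
  fixes f w :: "'a \<Rightarrow> real"
  assumes "finite I" and "\<And>i. i \<in> I \<Longrightarrow> 0 < w i" and "sum w I = 1"
    and "\<And>i. i \<in> I \<Longrightarrow> f i \<le> c" and "(\<Sum>i\<in>I. w i * f i) = c"
    and "i \<in> I"
  shows "f i = c"
proof -
  have nonneg: "0 \<le> w j * (c - f j)" if "j \<in> I" for j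
    using assms(2,4)[OF that] by simp
  have "(\<Sum>i\<in>I. w i * (c - f i)) = sum w I * c - (\<Sum>i\<in>I. w i * f i)"
    by (simp add: right_diff_distrib sum_subtractf sum_distrib_right)
  also have "\<dots> = 0"
    using assms(3,5) by simp
  finally have "w i * (c - f i) = 0"
    using sum_nonneg_eq_0_iff[of I "\<lambda>j. w j * (c - f j)"] assms(1,6) nonneg by blast
  then show ?thesis
    using assms(2)[OF assms(6)] by simp
qed

theorem proposition1p2:
  fixes A :: "real ^ 'n ^ 'n"
    and P :: "'m::finite \<Rightarrow> real ^ 'n ^ 'n"
    and x :: "real ^ 'm"
    and M :: "real ^ 'm ^ 'm"
  assumes "A \<in> bistochastic"
    and "A = (\<Sum>i\<in>UNIV. (x $ i) *\<^sub>R P i)"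
    and "\<And>i. permutation_matrix (P i)"
    and "\<And>i. x $ i > 0"
    and "(\<Sum>i\<in>UNIV. x $ i) = 1"
    and "M = (\<chi> i j. frobenius_inner (P i) (P j))"
    and "erdos_matrix A"
  shows "M *v x = ((M *v x) \<bullet> x) *\<^sub>R (1 :: real ^ 'm)"
proof -
  have Mx: "(M *v x) $ i = P i \<bullet> A" for i
    by (simp add: assms(2,6) matrix_vector_mult_def frobenius_inner_eq_inner inner_sum_right mult.commute)
  have mean: "(\<Sum>i\<in>UNIV. x $ i * (P i \<bullet> A)) = A \<bullet> A"
    using arg_cong[OF assms(2), of "\<lambda>B. B \<bullet> A"]
    by (simp only: inner_sum_left inner_scaleR_left)
  have "A \<bullet> A = maxTrace A"
    using assms(7)
    by (simp add: erdos_matrix_def frobenius_norm_def frobenius_inner_eq_inner)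
  then have "P i \<bullet> A \<le> A \<bullet> A" for i
    using permutation_matrix_inner_le_maxTrace[OF assms(3)] by metis
  then have "P i \<bullet> A = A \<bullet> A" for i
    using weighted_mean_attains_bound[of UNIV "\<lambda>i. x $ i" "\<lambda>i. P i \<bullet> A" "A \<bullet> A" i]
      assms(4,5) mean by simp
  moreover have "(M *v x) \<bullet> x = A \<bullet> A"
    unfolding mean[symmetric] by (simp add: inner_vec_def Mx mult.commute)
  ultimately show ?thesis
    by (simp add: vec_eq_iff Mx)
qed

end
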